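(* Consider the following collection of EQUAL gates and cogates: the 1-arity gate $|0\rangle+|1\rangle$, the 1-arity cogate $\langle0|+\langle1|$, the 2-arity cogate $\langle00|+\langle11|$, the 3-arity gate $|000\rangle+|111\rangle$, and the 3-arity cogate $\langle000|+\langle111|$. 1. There does not exist an invertible matrix $A\in\mathbb{C}^{2\times2}$ such that all the gates and cogates in this collection are simultaneously Pfaffian under the homogeneous change of basis $A$ (i.e. each gate under $A^{\otimes n}$ and each cogate under $(A^{-1})^{\otimes n}$, $n$ being its arity). 2. There do exist invertible matrices $A,B\in\mathbb{C}^{2\times2}$ such that, simultaneously: $|0\rangle+|1\rangle$ is Pfaffian under $A$; $\langle0|+\langle1|$ is Pfaffian under $B^{-1}$; $\langle00|+\langle11|$ is Pfaffian under $A^{-1}\otimes A^{-1}$; $|000\rangle+|111\rangle$ is Pfaffian under $A\otimes B\otimes B$; and $\langle000|+\langle111|$ is Pfaffian under $B^{-1}\otimes A^{-1}\otimes A^{-1}$.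
   Context: Let $V=\mathbb{C}^2$ with basis $|0\rangle,|1\rangle$ and dual basis $\langle0|,\langle1|$. An $n$-arity gate is an element of $V^{\otimes n}$, and an $n$-arity cogate is an element of $(V^* )^{\otimes n}$. For $I\subseteq[n]=\{1,\dots,n\}$, $|I\rangle$ and $\langle I|$ denote the basis ket and bra whose bitstring is the indicator of $I$, and $I^C=[n]\setminus I$. Rows and columns of $2\times2$ matrices are indexed by $0,1$. A matrix $M$ acts on kets by $M|j\rangle=M_{0j}|0\rangle+M_{1j}|1\rangle$ and on bras by $M\langle j|=M_{j0}\langle0|+M_{j1}\langle1|$ (row-vector multiplication). For an $n\times n$ complex skew-symmetric matrix $\Xi$ put $\mathrm{sPf}(\Xi)=\sum_{I\subseteq[n]}\mathrm{Pf}(\Xi|_I)|I\rangle$ and $\mathrm{sPf}^*(\Xi)=\sum_{J\subseteq[n]}\mathrm{Pf}(\Xi|_{J^C})\langle J|$, where $\Xi|_I$ is the submatrix with rows and columns in $I$, and the Pfaffian $\mathrm{Pf}$ is $1$ for the empty matrix and $0$ for odd size. A gate $G$ of arity $n$ is Pfaffian under $A_1\otimes\cdots\otimes A_n$ if $(A_1\otimes\cdots\otimes A_n)G=\alpha\,\mathrm{sPf}(\Xi)$ for some $\alpha\in\mathbb{C}$ and skew-symmetric $\Xi\in\mathbb{C}^{n\times n}$. A cogate $C$ of arity $n$ is Pfaffian under $A_1^{-1}\otimes\cdots\otimes A_n^{-1}$ if $(A_1^{-1}\otimes\cdots\otimes A_n^{-1})C=\beta\,\mathrm{sPf}^*(\Theta)$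 for some $\beta\in\mathbb{C}$ and skew-symmetric $\Theta\in\mathbb{C}^{n\times n}$. *)

theory Defs
  imports
    Complex_Main
    "Jordan_Normal_Form.Determinant"
    "Jordan_Normal_Form.Gauss_Jordan_Elimination"
    "Jordan_Normal_Form.DL_Submatrix"
begin

text \<open>
  The tensor factors are numbered \<open>0, \<dots>, n - 1\<close>. A gate or a cogate of arity \<open>n\<close> is
  given by its coefficients in the basis of kets \<open>|I\<rangle>\<close>, respectively of bras \<open>\<langle>I|\<close>,
  for \<open>I \<subseteq> {0..<n}\<close>; its values at other sets play no role in what follows.
\<close>

type_synonym gate = "nat set \<Rightarrow> complex"
type_synonym cogate = "nat set \<Rightarrow> complex"

definition ket :: "nat set \<Rightarrow> gate" where
  "ket I = (\<lambda>J. if J = I then 1 else 0)"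

definition bra :: "nat set \<Rightarrow> cogate" where
  "bra I = (\<lambda>J. if J = I then 1 else 0)"

definition equal_gate :: "nat \<Rightarrow> gate" where
  "equal_gate n = (\<lambda>I. ket {} I + ket {0..<n} I)"

definition equal_cogate :: "nat \<Rightarrow> cogate" where
  "equal_cogate n = (\<lambda>I. bra {} I + bra {0..<n} I)"

text \<open>
  A list \<open>[M\<^sub>0, \<dots>, M\<^sub>n\<^sub>-\<^sub>1]\<close> of \<open>2 \<times> 2\<close> matrices stands for \<open>M\<^sub>0 \<otimes> \<dots> \<otimes> M\<^sub>n\<^sub>-\<^sub>1\<close>, and its
  length is the arity. On kets \<open>M|j\<rangle> = \<Sum>\<^sub>k M\<^sub>k\<^sub>j |k\<rangle>\<close>, whereas on bras
  \<open>M\<langle>j| = \<Sum>\<^sub>k M\<^sub>j\<^sub>k \<langle>k|\<close>, which is why the two indices are swapped between the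
  two definitions.
\<close>

definition act_gate :: "complex mat list \<Rightarrow> gate \<Rightarrow> gate" where
  "act_gate Ms G = (\<lambda>K. \<Sum>J\<in>Pow {0..<length Ms}.
     (\<Prod>i<length Ms. (Ms ! i) $$ (of_bool (i \<in> K), of_bool (i \<in> J))) * G J)"

definition act_cogate :: "complex mat list \<Rightarrow> cogate \<Rightarrow> cogate" where
  "act_cogate Ms C = (\<lambda>K. \<Sum>J\<in>Pow {0..<length Ms}.
     C J * (\<Prod>i<length Ms. (Ms ! i) $$ (of_bool (i \<in> J), of_bool (i \<in> K))))"

definition skew_symmetric_mat :: "nat \<Rightarrow> complex mat \<Rightarrow> bool" where
  "skew_symmetric_mat n X \<longleftrightarrow> X \<in> carrier_mat n n \<and> transpose_mat X = - X"

text \<open>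
  For even size \<open>n = 2m\<close> this is the sum over all permutations; the factor
  \<open>2\<^sup>m m!\<close> is the number of permutations that describe the same perfect matching.
\<close>

definition pfaffian :: "complex mat \<Rightarrow> complex" where
  "pfaffian X = (let n = dim_row X; m = n div 2 in
     if odd n then 0
     else (\<Sum>p | p permutes {0..<n}.
             signof p * (\<Prod>i<m. X $$ (p (2 * i), p (2 * i + 1)))) / (2 ^ m * fact m))"

definition sPf :: "complex mat \<Rightarrow> gate" where
  "sPf X = (\<lambda>I. pfaffian (submatrix X I I))"

definition sPf_dual :: "complex mat \<Rightarrow> cogate" where
  "sPf_dual X = (\<lambda>J. let J' = {0..<dim_row X} - J in pfaffian (submatrix X J' J'))"

definition pfaffian_gate_under :: "complex mat list \<Rightarrow> gate \<Rightarrow> bool" where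
  "pfaffian_gate_under Ms G \<longleftrightarrow>
     (\<exists>\<alpha> X. skew_symmetric_mat (length Ms) X \<and>
       (\<forall>I\<subseteq>{0..<length Ms}. act_gate Ms G I = \<alpha> * sPf X I))"

definition pfaffian_cogate_under :: "complex mat list \<Rightarrow> cogate \<Rightarrow> bool" where
  "pfaffian_cogate_under Ms C \<longleftrightarrow>
     (\<exists>\<beta> X. skew_symmetric_mat (length Ms) X \<and>
       (\<forall>J\<subseteq>{0..<length Ms}. act_cogate Ms C J = \<beta> * sPf_dual X J))"

text \<open>The inverse of an invertible matrix; unspecified for other matrices.\<close>

definition inv_mat :: "complex mat \<Rightarrow> complex mat" where
  "inv_mat A = the (mat_inverse A)"

end

theory Submission
  imports Defs
begin

text \<open>
  The obstruction to a homogeneous change of basis sits in arity 1 alone. An arity-1 gate is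
  Pfaffian exactly when it is a multiple of \<open>|0\<rangle>\<close>, and an arity-1 cogate exactly when it is a
  multiple of \<open>\<langle>1|\<close>, because odd Pfaffians vanish. So if a single \<open>A\<close> served both
  \<open>g = |0\<rangle> + |1\<rangle>\<close> and \<open>c = \<langle>0| + \<langle>1|\<close>, the pairing of \<open>A\<^sup>-\<^sup>1 c\<close> with \<open>A g\<close> would be a multiple of
  \<open>\<langle>1|0\<rangle> = 0\<close>; but this pairing does not depend on the basis and equals the pairing of \<open>c\<close>
  with \<open>g\<close>, which is \<open>2\<close> (\<open>not_both_pfaffian_arity_1\<close>).

  With two bases the conflict disappears, since \<open>g\<close> is then transformed by \<open>A\<close> and \<open>c\<close> by
  \<open>B\<^sup>-\<^sup>1\<close>. The first forces the second row of \<open>A\<close> to be a multiple of \<open>(1, -1)\<close>, the second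
  forces that of \<open>B\<close> to be a multiple of \<open>(1, 1)\<close>. Parity then leaves little choice for the
  first rows: for \<open>\<langle>00| + \<langle>11|\<close> to lose its odd part the first row of \<open>A\<close> must be proportional
  to \<open>(1, 1)\<close>, and for \<open>|000\<rangle> + |111\<rangle>\<close> to lose its odd part the first row of \<open>B\<close> must be
  proportional to \<open>(1, -1)\<close>. Up to scaling the rows, \<open>A\<close>
  is the matrix with rows \<open>(1, 1)\<close> and \<open>(1, -1)\<close>, and \<open>B\<close> the one with rows \<open>(1, -1)\<close> and \<open>(1, 1)\<close>.
  After these changes of basis each gate is constant on the bitstrings with an even number of
  ones and zero elsewhere, and each cogate is constant on those with an even number of zeros and
  zero elsewhere. Such tensors are Pfaffian for the skew-symmetric matrix whose entries above the
  diagonal are all \<open>1\<close>, since every even principal Pfaffian of that matrix is \<open>1\<close>; in arity at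
  most \<open>3\<close> only the sizes \<open>0\<close> and \<open>2\<close> matter (\<open>pfaffian_gate_if_parity\<close> and
  \<open>pfaffian_cogate_if_parity\<close>).
\<close>

section \<open>Pfaffians of small matrices\<close>

lemma pfaffian_odd: "odd (dim_row X) \<Longrightarrow> pfaffian X = 0"
  by (simp add: pfaffian_def Let_def)

lemma pfaffian_0: "dim_row X = 0 \<Longrightarrow> pfaffian X = 1"
  by (simp add: pfaffian_def Let_def)

lemma pfaffian_2:
  assumes "dim_row X = 2"
  shows "pfaffian X = (X $$ (0, 1) - X $$ (1, 0)) / 2"
proof -
  have "{0..<2::nat} = insert 0 {1}" by auto
  then have "(\<Sum>p | p permutes {0..<2::nat}. signof p * X $$ (p 0, p 1))
      = X $$ (0, 1) - X $$ (1, 0)"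
    by (simp add: sum_over_permutations_insert sign_swap_id sign_id)
  then show ?thesis
    using assms by (simp add: pfaffian_def Let_def)
qed

definition upper_ones :: "nat \<Rightarrow> complex mat" where
  "upper_ones n = mat n n (\<lambda>(i, j). if i < j then 1 else if j < i then -1 else 0)"

lemma skew_symmetric_upper_ones: "skew_symmetric_mat n (upper_ones n)"
  by (auto simp: skew_symmetric_mat_def upper_ones_def)

text \<open>
  Selecting the same rows and columns keeps their order, so a principal submatrix depends only
  on its size.
\<close>

lemma submatrix_upper_ones:
  assumes "I \<subseteq> {0..<n}"
  shows "submatrix (upper_ones n) I I = upper_ones (card I)"
proof -
  have I: "{i. i < n \<and> i \<in> I} = I" using assms by auto
  have less: "pick I i < n" if "i < card I" for i
    using pick_le[of i n I] that I by simp
  have mono: "pick I i < pick I j \<longleftrightarrow> i < j" if "i < card I" "j < card I" for i j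
    using that pick_mono_le[of i I j] pick_mono_le[of j I i]
    by (metis not_less_iff_gr_or_eq)
  show ?thesis
    by (rule eq_matI) (auto simp: submatrix_def upper_ones_def I less mono)
qed

lemma pfaffian_upper_ones:
  assumes "n \<le> 3"
  shows "pfaffian (upper_ones n) = of_bool (even n)"
proof -
  have dim: "dim_row (upper_ones n) = n" by (simp add: upper_ones_def)
  consider "n = 0" | "n = 1" | "n = 2" | "n = 3"
    using assms by linarith
  then show ?thesis
    using dim by cases (simp_all add: pfaffian_odd pfaffian_0 pfaffian_2, simp add: upper_ones_def)
qed

section \<open>Sufficient and necessary parity conditions\<close>

lemma card_eq_sum_of_bool: "I \<subseteq> {0..<n::nat} \<Longrightarrow> card I = (\<Sum>i<n. of_bool (i \<in> I))"
proof -
  assume "I \<subseteq> {0..<n}"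
  then have "{..<n} \<inter> {i. i \<in> I} = I" by auto
  then show ?thesis by (subst sum_of_bool_eq) simp_all
qed

text \<open>
  The next two lemmas turn the search for a skew-symmetric matrix into a parity check: they
  supply \<open>upper_ones\<close> as the witness. The parity is that of a sum over the tensor factors,
  so that it can be read off one membership bit at a time.
\<close>

lemma pfaffian_gate_if_parity:
  assumes "length Ms \<le> 3"
    and "\<And>I. act_gate Ms G I = \<alpha> * of_bool (even (\<Sum>i<length Ms. of_bool (i \<in> I) :: nat))"
  shows "pfaffian_gate_under Ms G"
  unfolding pfaffian_gate_under_def
proof (intro exI conjI allI impI)
  show "skew_symmetric_mat (length Ms) (upper_ones (length Ms))"
    by (rule skew_symmetric_upper_ones)
  fix I assume I: "I \<subseteq> {0..<length Ms}"
  then have "card I \<le> 3"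
    using assms(1) card_mono[OF _ I] by simp
  then have "sPf (upper_ones (length Ms)) I = of_bool (even (card I))"
    using I by (simp add: sPf_def submatrix_upper_ones pfaffian_upper_ones)
  then show "act_gate Ms G I = \<alpha> * sPf (upper_ones (length Ms)) I"
    unfolding assms(2) card_eq_sum_of_bool[OF I] by (rule ssubst) (rule refl)
qed

lemma pfaffian_cogate_if_parity:
  assumes "length Ms \<le> 3"
    and "\<And>J. act_cogate Ms C J = \<beta> * of_bool (even (\<Sum>i<length Ms. of_bool (i \<notin> J) :: nat))"
  shows "pfaffian_cogate_under Ms C"
  unfolding pfaffian_cogate_under_def
proof (intro exI conjI allI impI)
  show "skew_symmetric_mat (length Ms) (upper_ones (length Ms))"
    by (rule skew_symmetric_upper_ones)
  fix J assume "J \<subseteq> {0..<length Ms}"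
  define J' where "J' = {0..<length Ms} - J"
  have J': "J' \<subseteq> {0..<length Ms}" by (auto simp: J'_def)
  then have "card J' \<le> 3"
    using assms(1) card_mono[OF _ J'] by simp
  moreover have "dim_row (upper_ones (length Ms)) = length Ms"
    by (simp add: upper_ones_def)
  ultimately have sPf: "sPf_dual (upper_ones (length Ms)) J = of_bool (even (card J'))"
    using J' by (simp add: sPf_dual_def Let_def submatrix_upper_ones pfaffian_upper_ones
        flip: J'_def)
  have "card J' = (\<Sum>i<length Ms. of_bool (i \<notin> J))"
    unfolding card_eq_sum_of_bool[OF J'] by (intro sum.cong) (auto simp: J'_def)
  then show "act_cogate Ms C J = \<beta> * sPf_dual (upper_ones (length Ms)) J"
    unfolding assms(2) sPf by (rule ssubst) (rule refl)
qed

text \<open>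
  An EQUAL tensor is a sum of two product tensors, hence so is its image under a change of
  basis: every coefficient is a sum of two products instead of \<open>2\<^sup>n\<close> terms.
\<close>

lemma act_equal_gate:
  "act_gate Ms (equal_gate (length Ms)) K
    = (\<Prod>i<length Ms. (Ms ! i) $$ (of_bool (i \<in> K), 0))
      + (\<Prod>i<length Ms. (Ms ! i) $$ (of_bool (i \<in> K), 1))"
proof -
  let ?f = "\<lambda>J. \<Prod>i<length Ms. (Ms ! i) $$ (of_bool (i \<in> K), of_bool (i \<in> J))"
  let ?N = "{0..<length Ms}"
  have "act_gate Ms (equal_gate (length Ms)) K
      = (\<Sum>J\<in>Pow ?N. (if J = {} then ?f J else 0) + (if J = ?N then ?f J else 0))"
    unfolding act_gate_def equal_gate_def ket_def by (intro sum.cong) (auto simp: distrib_left)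
  also have "\<dots> = ?f {} + ?f ?N"
    by (simp add: sum.distrib sum.delta)
  finally show ?thesis by simp
qed

lemma act_equal_cogate:
  "act_cogate Ms (equal_cogate (length Ms)) K
    = (\<Prod>i<length Ms. (Ms ! i) $$ (0, of_bool (i \<in> K)))
      + (\<Prod>i<length Ms. (Ms ! i) $$ (1, of_bool (i \<in> K)))"
proof -
  let ?f = "\<lambda>J. \<Prod>i<length Ms. (Ms ! i) $$ (of_bool (i \<in> J), of_bool (i \<in> K))"
  let ?N = "{0..<length Ms}"
  have "act_cogate Ms (equal_cogate (length Ms)) K
      = (\<Sum>J\<in>Pow ?N. (if J = {} then ?f J else 0) + (if J = ?N then ?f J else 0))"
    unfolding act_cogate_def equal_cogate_def bra_def by (intro sum.cong) (auto simp: distrib_right)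
  also have "\<dots> = ?f {} + ?f ?N"
    by (simp add: sum.distrib sum.delta)
  finally show ?thesis by simp
qed

text \<open>
  In arity 1 one coefficient has to vanish because the Pfaffian of a \<open>1 \<times> 1\<close> matrix does: for a
  gate it is that of \<open>|1\<rangle>\<close>, for a cogate, whose Pfaffians are taken on the complement, it is that
  of \<open>\<langle>0|\<close>.
\<close>

lemma pfaffian_gate_1D:
  assumes "pfaffian_gate_under [A] (equal_gate 1)"
  shows "A $$ (1, 0) + A $$ (1, 1) = 0"
proof -
  obtain \<alpha> X where X: "X \<in> carrier_mat 1 1"
    and eq: "act_gate [A] (equal_gate 1) {0} = \<alpha> * sPf X {0}"
    using assms by (auto simp: pfaffian_gate_under_def skew_symmetric_mat_def)
  have "{i. i < dim_row X \<and> i \<in> {0}} = {0}" using X by auto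
  then have "sPf X {0} = 0"
    unfolding sPf_def by (intro pfaffian_odd) (simp add: dim_submatrix)
  with eq act_equal_gate[of "[A]" "{0}"] show ?thesis by simp
qed

lemma pfaffian_cogate_1D:
  assumes "pfaffian_cogate_under [C] (equal_cogate 1)"
  shows "C $$ (0, 0) + C $$ (1, 0) = 0"
proof -
  obtain \<beta> X where X: "X \<in> carrier_mat 1 1"
    and eq: "act_cogate [C] (equal_cogate 1) {} = \<beta> * sPf_dual X {}"
    using assms by (auto simp: pfaffian_cogate_under_def skew_symmetric_mat_def)
  have "{i. i < dim_row X \<and> i \<in> {0..<dim_row X} - {}} = {0}" using X by auto
  then have "sPf_dual X {} = 0"
    unfolding sPf_dual_def Let_def by (intro pfaffian_odd) (simp add: dim_submatrix)
  with eq act_equal_cogate[of "[C]" "{}"] show ?thesis by simp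
qed

section \<open>Obstruction to a single basis\<close>

lemma inv_mat_unique:
  assumes A: "A \<in> carrier_mat n n" and C: "C \<in> carrier_mat n n"
    and AC: "A * C = 1\<^sub>m n" and CA: "C * A = 1\<^sub>m n"
  shows "inv_mat A = C"
proof -
  have "A \<in> Units (ring_mat TYPE(complex) n ())"
    using assms by (auto simp: Units_def ring_mat_def)
  then obtain D where D: "mat_inverse A = Some D"
    using mat_inverse(1)[OF A, where b = "()"] by (cases "mat_inverse A") auto
  then have AD: "A * D = 1\<^sub>m n" and Dc: "D \<in> carrier_mat n n"
    using mat_inverse(2)[OF A D] by auto
  have "C = C * (A * D)" using AD C by simp
  also have "\<dots> = (C * A) * D" by (rule assoc_mult_mat[OF C A Dc, symmetric])
  also have "\<dots> = D" using CA Dc by simp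
  finally have "C = D" .
  with D show ?thesis by (simp add: inv_mat_def)
qed

lemma invertible_matE:
  assumes A: "A \<in> carrier_mat n n" and "invertible_mat A"
  obtains C where "C \<in> carrier_mat n n" "A * C = 1\<^sub>m n" "C * A = 1\<^sub>m n"
proof -
  obtain C where AC: "A * C = 1\<^sub>m n" and CA: "C * A = 1\<^sub>m (dim_row C)"
    using assms by (auto simp: invertible_mat_def inverts_mat_def)
  have "dim_row C = n"
    using arg_cong[OF CA, of dim_col] A by simp
  moreover have "dim_col C = n"
    using arg_cong[OF AC, of dim_col] by simp
  ultimately show thesis using AC CA that[of C] by auto
qed

lemma invertible_matI:
  assumes "A \<in> carrier_mat n n" "C \<in> carrier_mat n n" "A * C = 1\<^sub>m n" "C * A = 1\<^sub>m n"
  shows "invertible_mat A"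
  using assms by (auto simp: invertible_mat_def inverts_mat_def)

lemma mult_mat_2_index:
  assumes "M \<in> carrier_mat 2 2" "N \<in> carrier_mat 2 2" "i < 2" "k < 2"
  shows "(M * N) $$ (i, k) = M $$ (i, 0) * N $$ (0, k) + M $$ (i, 1) * N $$ (1, k)"
  using assms by (simp add: scalar_prod_def numeral_2_eq_2)

lemma not_both_pfaffian_arity_1:
  assumes A: "A \<in> carrier_mat 2 2" and inv: "invertible_mat A"
    and gate: "pfaffian_gate_under [A] (equal_gate 1)"
    and cogate: "pfaffian_cogate_under [inv_mat A] (equal_cogate 1)"
  shows False
proof -
  obtain C where C: "C \<in> carrier_mat 2 2" and AC: "A * C = 1\<^sub>m 2" and CA: "C * A = 1\<^sub>m 2"
    using invertible_matE[OF A inv] .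
  have row: "A $$ (1, 0) + A $$ (1, 1) = 0"
    using pfaffian_gate_1D[OF gate] .
  have col: "C $$ (0, 0) + C $$ (1, 0) = 0"
    using pfaffian_cogate_1D[OF cogate] inv_mat_unique[OF A C AC CA] by simp
  have entry: "C $$ (i, 0) * A $$ (0, k) + C $$ (i, 1) * A $$ (1, k) = (if i = k then 1 else 0)"
    if "i < 2" "k < 2" for i k
    using arg_cong[OF CA, of "\<lambda>M. M $$ (i, k)"] that
    unfolding mult_mat_2_index[OF C A that] by simp
  \<comment> \<open>The sum of all four entries of \<open>A\<^sup>-\<^sup>1 A\<close> is the pairing of the transformed cogate with the
    transformed gate.\<close>
  have "(C $$ (0, 0) + C $$ (1, 0)) * (A $$ (0, 0) + A $$ (0, 1))
      + (C $$ (0, 1) + C $$ (1, 1)) * (A $$ (1, 0) + A $$ (1, 1)) = 2"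
    using entry[of 0 0] entry[of 0 1] entry[of 1 0] entry[of 1 1] by (simp add: algebra_simps)
  then show False using row col by simp
qed

section \<open>Two bases that work\<close>

definition mat2 :: "complex \<Rightarrow> complex \<Rightarrow> complex \<Rightarrow> complex \<Rightarrow> complex mat" where
  "mat2 a b c d = mat 2 2 (\<lambda>(i, j). if i = 0 then (if j = 0 then a else b)
                                   else (if j = 0 then c else d))"

lemma mat2_carrier: "mat2 a b c d \<in> carrier_mat 2 2"
  by (simp add: mat2_def)

lemma mat2_entries:
  "mat2 a b c d $$ (0, 0) = a" "mat2 a b c d $$ (0, 1) = b"
  "mat2 a b c d $$ (1, 0) = c" "mat2 a b c d $$ (1, 1) = d"
  by (simp_all add: mat2_def)

lemma mat2_times_mat2:
  "mat2 a b c d * mat2 a' b' c' d'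
    = mat2 (a * a' + b * c') (a * b' + b * d') (c * a' + d * c') (c * b' + d * d')"
  (is "?L = ?R")
proof (rule eq_matI)
  fix i j assume "i < dim_row ?R" "j < dim_col ?R"
  then have ij: "i < 2" "j < 2" by (simp_all add: mat2_def)
  then have "i = 0 \<or> i = 1" "j = 0 \<or> j = 1" by linarith+
  then show "?L $$ (i, j) = ?R $$ (i, j)"
    unfolding mult_mat_2_index[OF mat2_carrier mat2_carrier ij]
    by (elim disjE) (simp_all only: mat2_entries)
qed (simp_all add: mat2_def)

lemma one_mat_2: "1\<^sub>m 2 = mat2 1 0 0 1"
proof (rule eq_matI)
  fix i j assume "i < dim_row (mat2 1 0 0 1)" "j < dim_col (mat2 1 0 0 1)"
  then have "i < 2" "j < 2" by (simp_all add: mat2_def)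
  then show "1\<^sub>m 2 $$ (i, j) = mat2 1 0 0 1 $$ (i, j)" by (auto simp: mat2_def)
qed (simp_all add: mat2_def)

definition basis_A :: "complex mat" where
  "basis_A = mat2 1 1 1 (-1)"

definition basis_B :: "complex mat" where
  "basis_B = mat2 1 (-1) 1 1"

definition basis_A_inv :: "complex mat" where
  "basis_A_inv = mat2 (1/2) (1/2) (1/2) (-1/2)"

definition basis_B_inv :: "complex mat" where
  "basis_B_inv = mat2 (1/2) (1/2) (-1/2) (1/2)"

lemmas basis_defs = basis_A_def basis_B_def basis_A_inv_def basis_B_inv_def

lemma basis_carrier:
  "basis_A \<in> carrier_mat 2 2" "basis_B \<in> carrier_mat 2 2"
  "basis_A_inv \<in> carrier_mat 2 2" "basis_B_inv \<in> carrier_mat 2 2"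
  by (simp_all add: basis_defs mat2_carrier)

lemma basis_inverses:
  "basis_A * basis_A_inv = 1\<^sub>m 2" "basis_A_inv * basis_A = 1\<^sub>m 2"
  "basis_B * basis_B_inv = 1\<^sub>m 2" "basis_B_inv * basis_B = 1\<^sub>m 2"
  by (simp_all add: basis_defs mat2_times_mat2 one_mat_2)

lemma inv_basis: "inv_mat basis_A = basis_A_inv" "inv_mat basis_B = basis_B_inv"
  using inv_mat_unique[OF basis_carrier(1,3) basis_inverses(1,2)]
    inv_mat_unique[OF basis_carrier(2,4) basis_inverses(3,4)] .

lemma sum_lessThan_1: "(\<Sum>i<1. f i) = f (0::nat)"
  by simp

lemma sum_prod_lessThan_2:
  fixes f :: "nat \<Rightarrow> 'a :: comm_semiring_1"
  shows "(\<Sum>i<2. f i) = f 0 + f 1" "(\<Prod>i<2. f i) = f 0 * f 1"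
  by (simp_all add: numeral_2_eq_2)

lemma sum_prod_lessThan_3:
  fixes f :: "nat \<Rightarrow> 'a :: comm_semiring_1"
  shows "(\<Sum>i<3. f i) = f 0 + f 1 + f 2" "(\<Prod>i<3. f i) = f 0 * f 1 * f 2"
  by (simp_all add: numeral_3_eq_3 numeral_2_eq_2)

lemma gate_1_pfaffian: "pfaffian_gate_under [basis_A] (equal_gate 1)"
proof (rule pfaffian_gate_if_parity[where \<alpha> = "2"])
  fix I
  have len: "length [basis_A] = 1" by simp
  have "act_gate [basis_A] (equal_gate 1) I
      = basis_A $$ (of_bool (0 \<in> I), 0)
        + basis_A $$ (of_bool (0 \<in> I), 1)"
    using act_equal_gate[of "[basis_A]" I] unfolding len by (simp)
  then show "act_gate [basis_A] (equal_gate 1) I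
      = 2 * of_bool (even (\<Sum>i<length [basis_A]. of_bool (i \<in> I) :: nat))"
    unfolding len
    by (cases "0 \<in> I") (simp_all add: sum_lessThan_1 basis_defs mat2_entries del: One_nat_def)
qed simp

lemma cogate_1_pfaffian: "pfaffian_cogate_under [basis_B_inv] (equal_cogate 1)"
proof (rule pfaffian_cogate_if_parity[where \<beta> = "1"])
  fix J
  have len: "length [basis_B_inv] = 1" by simp
  have "act_cogate [basis_B_inv] (equal_cogate 1) J
      = basis_B_inv $$ (0, of_bool (0 \<in> J))
        + basis_B_inv $$ (1, of_bool (0 \<in> J))"
    using act_equal_cogate[of "[basis_B_inv]" J] unfolding len by (simp)
  then show "act_cogate [basis_B_inv] (equal_cogate 1) J
      = 1 * of_bool (even (\<Sum>i<length [basis_B_inv]. of_bool (i \<notin> J) :: nat))"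
    unfolding len
    by (cases "0 \<in> J") (simp_all add: sum_lessThan_1 basis_defs mat2_entries del: One_nat_def)
qed simp

lemma cogate_2_pfaffian: "pfaffian_cogate_under [basis_A_inv, basis_A_inv] (equal_cogate 2)"
proof (rule pfaffian_cogate_if_parity[where \<beta> = "1/2"])
  fix J
  have len: "length [basis_A_inv, basis_A_inv] = 2" by simp
  have "act_cogate [basis_A_inv, basis_A_inv] (equal_cogate 2) J
      = basis_A_inv $$ (0, of_bool (0 \<in> J)) * basis_A_inv $$ (0, of_bool (1 \<in> J))
        + basis_A_inv $$ (1, of_bool (0 \<in> J)) * basis_A_inv $$ (1, of_bool (1 \<in> J))"
    using act_equal_cogate[of "[basis_A_inv, basis_A_inv]" J] unfolding len by (simp add: sum_prod_lessThan_2)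
  then show "act_cogate [basis_A_inv, basis_A_inv] (equal_cogate 2) J
      = 1/2 * of_bool (even (\<Sum>i<length [basis_A_inv, basis_A_inv]. of_bool (i \<notin> J) :: nat))"
    unfolding len
    by (cases "0 \<in> J"; cases "1 \<in> J") (simp_all add: sum_prod_lessThan_2 basis_defs mat2_entries del: One_nat_def)
qed simp

lemma gate_3_pfaffian: "pfaffian_gate_under [basis_A, basis_B, basis_B] (equal_gate 3)"
proof (rule pfaffian_gate_if_parity[where \<alpha> = "2"])
  fix I
  have len: "length [basis_A, basis_B, basis_B] = 3" by simp
  have "act_gate [basis_A, basis_B, basis_B] (equal_gate 3) I
      = basis_A $$ (of_bool (0 \<in> I), 0) * basis_B $$ (of_bool (1 \<in> I), 0) * basis_B $$ (of_bool (2 \<in> I), 0)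
        + basis_A $$ (of_bool (0 \<in> I), 1) * basis_B $$ (of_bool (1 \<in> I), 1) * basis_B $$ (of_bool (2 \<in> I), 1)"
    using act_equal_gate[of "[basis_A, basis_B, basis_B]" I] unfolding len by (simp add: sum_prod_lessThan_3)
  then show "act_gate [basis_A, basis_B, basis_B] (equal_gate 3) I
      = 2 * of_bool (even (\<Sum>i<length [basis_A, basis_B, basis_B]. of_bool (i \<in> I) :: nat))"
    unfolding len
    by (cases "0 \<in> I"; cases "1 \<in> I"; cases "2 \<in> I") (simp_all add: sum_prod_lessThan_3 basis_defs mat2_entries del: One_nat_def)
qed simp

lemma cogate_3_pfaffian:
  "pfaffian_cogate_under [basis_B_inv, basis_A_inv, basis_A_inv] (equal_cogate 3)"
proof (rule pfaffian_cogate_if_parity[where \<beta> = "1/4"])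
  fix J
  have len: "length [basis_B_inv, basis_A_inv, basis_A_inv] = 3" by simp
  have "act_cogate [basis_B_inv, basis_A_inv, basis_A_inv] (equal_cogate 3) J
      = basis_B_inv $$ (0, of_bool (0 \<in> J)) * basis_A_inv $$ (0, of_bool (1 \<in> J)) * basis_A_inv $$ (0, of_bool (2 \<in> J))
        + basis_B_inv $$ (1, of_bool (0 \<in> J)) * basis_A_inv $$ (1, of_bool (1 \<in> J)) * basis_A_inv $$ (1, of_bool (2 \<in> J))"
    using act_equal_cogate[of "[basis_B_inv, basis_A_inv, basis_A_inv]" J] unfolding len by (simp add: sum_prod_lessThan_3)
  then show "act_cogate [basis_B_inv, basis_A_inv, basis_A_inv] (equal_cogate 3) J
      = 1/4 * of_bool (even (\<Sum>i<length [basis_B_inv, basis_A_inv, basis_A_inv]. of_bool (i \<notin> J) :: nat))"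
    unfolding len
    by (cases "0 \<in> J"; cases "1 \<in> J"; cases "2 \<in> J") (simp_all add: sum_prod_lessThan_3 basis_defs mat2_entries del: One_nat_def)
qed simp

theorem theorem3:
  shows "(\<not> (\<exists>A :: complex mat. A \<in> carrier_mat 2 2 \<and> invertible_mat A \<and>
            pfaffian_gate_under (replicate 1 A) (equal_gate 1) \<and>
            pfaffian_cogate_under (replicate 1 (inv_mat A)) (equal_cogate 1) \<and>
            pfaffian_cogate_under (replicate 2 (inv_mat A)) (equal_cogate 2) \<and>
            pfaffian_gate_under (replicate 3 A) (equal_gate 3) \<and>
            pfaffian_cogate_under (replicate 3 (inv_mat A)) (equal_cogate 3)))
       \<and> (\<exists>(A :: complex mat) (B :: complex mat).
            A \<in> carrier_mat 2 2 \<and> invertible_mat A \<and>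
            B \<in> carrier_mat 2 2 \<and> invertible_mat B \<and>
            pfaffian_gate_under [A] (equal_gate 1) \<and>
            pfaffian_cogate_under [inv_mat B] (equal_cogate 1) \<and>
            pfaffian_cogate_under [inv_mat A, inv_mat A] (equal_cogate 2) \<and>
            pfaffian_gate_under [A, B, B] (equal_gate 3) \<and>
            pfaffian_cogate_under [inv_mat B, inv_mat A, inv_mat A] (equal_cogate 3))"
proof (intro conjI)
  show "\<not> (\<exists>A :: complex mat. A \<in> carrier_mat 2 2 \<and> invertible_mat A \<and>
            pfaffian_gate_under (replicate 1 A) (equal_gate 1) \<and>
            pfaffian_cogate_under (replicate 1 (inv_mat A)) (equal_cogate 1) \<and>
            pfaffian_cogate_under (replicate 2 (inv_mat A)) (equal_cogate 2) \<and>
            pfaffian_gate_under (replicate 3 A) (equal_gate 3) \<and>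
            pfaffian_cogate_under (replicate 3 (inv_mat A)) (equal_cogate 3))"
    using not_both_pfaffian_arity_1 by auto
  have "invertible_mat basis_A"
    by (rule invertible_matI[OF basis_carrier(1,3) basis_inverses(1,2)])
  moreover have "invertible_mat basis_B"
    by (rule invertible_matI[OF basis_carrier(2,4) basis_inverses(3,4)])
  ultimately show "\<exists>(A :: complex mat) (B :: complex mat).
            A \<in> carrier_mat 2 2 \<and> invertible_mat A \<and>
            B \<in> carrier_mat 2 2 \<and> invertible_mat B \<and>
            pfaffian_gate_under [A] (equal_gate 1) \<and>
            pfaffian_cogate_under [inv_mat B] (equal_cogate 1) \<and>
            pfaffian_cogate_under [inv_mat A, inv_mat A] (equal_cogate 2) \<and>
            pfaffian_gate_under [A, B, B] (equal_gate 3) \<and>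
            pfaffian_cogate_under [inv_mat B, inv_mat A, inv_mat A] (equal_cogate 3)"
    using basis_carrier(1,2) gate_1_pfaffian cogate_1_pfaffian cogate_2_pfaffian
      gate_3_pfaffian cogate_3_pfaffian
    by (intro exI[of _ basis_A] exI[of _ basis_B]) (simp add: inv_basis)
qed

end
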